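(* Let $n$ be a positive integer. We have $$J(n)=\frac{\pi^2}{12}\left(\frac1n-n\right)+\frac n2\log^2(2)+\sum_{j=1}^n\mathrm{Li}_2\left(\frac12\left(1+e^{\frac{\pi i}{n}(2j+1)}\right)\right),$$ and $$J\left(\frac1n\right)=\frac{\pi^2}{12}\left(n-\frac1n\right)+\left(1-\frac n2\right)\log^2(2)-\sum_{j=1}^n\mathrm{Li}_2\left(\frac12\left(1+e^{\frac{\pi i}{n}(2j+1)}\right)\right).$$
   Context: For $\mathrm{Re}(x)>0$, $J(x)=\int_0^1\frac{\log(1+t^x)}{1+t}\,dt$. $\mathrm{Li}_2(z)=\sum_{k\ge1}z^k/k^2$ for $|z|\le1$. *)

theory Defs
  imports "HOL-Analysis.Analysis"
begin

text \<open>
  Meant for \<open>Re x > 0\<close>. Since \<open>0 powr x = 0\<close> and \<open>norm (t powr x) < 1\<close> for \<open>0 \<le> t < 1\<close>, the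
  integrand is then continuous on \<open>[0, 1]\<close>, and \<open>Ln\<close> is applied only in the right half-plane.
\<close>
definition herglotz_J :: "complex \<Rightarrow> complex" where
  "herglotz_J x = integral {0..1} (\<lambda>t::real. Ln (1 + of_real t powr x) / (1 + of_real t))"

text \<open>Meant for \<open>norm z \<le> 1\<close>, where the series converges. The index is shifted to start at 0.\<close>
definition dilog :: "complex \<Rightarrow> complex" where
  "dilog z = (\<Sum>k. z ^ Suc k / of_nat (Suc k) ^ 2)"

end

theory Submission
  imports Defs "HOL-Computational_Algebra.Fundamental_Theorem_Algebra"
begin

text \<open>
  For \<open>w ^ n = -1\<close> let \<open>z\<^sub>w(t) = t (1 + w) / (1 + t)\<close>. This path runs inside the unit disc from
  \<open>0\<close> to \<open>(1 + w) / 2\<close>, the argument of a dilogarithm in the formula, and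
  \<open>1 - z\<^sub>w(t) = (1 - t w) / (1 + t)\<close>. As the dilogarithm satisfies \<open>d Li\<^sub>2(z) = - Ln (1 - z) d ln z\<close>
  and \<open>d ln z\<^sub>w = (1 / t - 1 / (1 + t)) dt\<close>, one gets
  \<open>d/dt Li\<^sub>2(z\<^sub>w(t)) = (ln (1 + t) - Ln (1 - t w)) (1 / t - 1 / (1 + t))\<close>. Since
  \<open>\<Prod> (1 - t w) = 1 + t ^ n\<close> over all \<open>w\<close>, summation gives
  \<open>(n ln (1 + t) - ln (1 + t ^ n)) (1 / t - 1 / (1 + t))\<close>.

  Expanding this, the term \<open>ln (1 + t ^ n) / (1 + t)\<close> is the integrand of \<open>J(n)\<close>, and the other three
  terms have elementary or dilogarithmic primitives: \<open>ln (1 + t ^ m) / t\<close> is the derivative of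
  \<open>- Li\<^sub>2(- t ^ m) / m\<close>, and \<open>ln (1 + t) / (1 + t)\<close> that of \<open>ln\<^sup>2 (1 + t) / 2\<close>. So \<open>J(n)\<close> has the explicit
  primitive \<open>herglotz_J_primitive\<close>, which vanishes at \<open>0\<close> and whose value at \<open>1\<close> is the asserted
  formula because \<open>Li\<^sub>2(-1) = - \<pi>\<^sup>2 / 12\<close>.

  The second formula is the first one combined with \<open>J(n) + J(1/n) = ln\<^sup>2 2\<close>, which is integration by
  parts after the substitution \<open>t = s ^ n\<close>. In terms of primitives: if \<open>F\<close> is one for \<open>J(n)\<close>, then
  \<open>ln (1 + root n t) ln (1 + t) - F (root n t)\<close> is one for \<open>J(1/n)\<close>.
\<close>

section \<open>The dilogarithm on the closed unit disc\<close>

lemma summable_inverse_squares: "summable (\<lambda>k. 1 / real (Suc k) ^ 2)"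
  using inverse_squares_sums by (simp add: sums_iff add.commute)

lemma norm_dilog_term_le:
  assumes "norm (z::complex) \<le> 1"
  shows "norm (z ^ Suc k / of_nat (Suc k) ^ 2) \<le> 1 / real (Suc k) ^ 2"
  unfolding norm_divide norm_power norm_of_nat
  by (intro divide_right_mono power_le_one assms) auto

lemma dilog_sums:
  assumes "norm z \<le> 1"
  shows "(\<lambda>k. z ^ Suc k / of_nat (Suc k) ^ 2) sums dilog z"
  unfolding dilog_def
  by (rule summable_sums, rule summable_comparison_test'[OF summable_inverse_squares])
     (rule norm_dilog_term_le[OF assms])

text \<open>
  Continuity up to the boundary circle is needed because the primitives below are evaluated at
  \<open>-1\<close>.
\<close>
lemma continuous_on_dilog: "continuous_on (cball 0 1) dilog"
proof -
  have "uniform_limit (cball 0 1) (\<lambda>n z. \<Sum>k<n. z ^ Suc k / of_nat (Suc k) ^ 2)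
          (\<lambda>z. \<Sum>k. z ^ Suc k / of_nat (Suc k) ^ 2 :: complex) sequentially"
    by (rule Weierstrass_m_test_ev[OF _ summable_inverse_squares])
       (intro always_eventually allI ballI norm_dilog_term_le, simp)
  hence "continuous_on (cball 0 1) (\<lambda>z. \<Sum>k. z ^ Suc k / of_nat (Suc k) ^ 2 :: complex)"
    by (rule uniform_limit_theorem[rotated])
       (auto intro!: always_eventually continuous_intros simp del: power_Suc of_nat_Suc)
  thus ?thesis
    by (simp add: dilog_def[abs_def])
qed

lemma dilog_0 [simp]: "dilog 0 = 0"
  by (simp add: dilog_def)

text \<open>
  Multiplying the differentiated series by \<open>z\<close> turns it into the series of \<open>- Ln (1 - z)\<close>. Keeping the
  factor \<open>z\<close> on the left avoids the removable singularity of \<open>- Ln (1 - z) / z\<close> at \<open>0\<close>.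
\<close>
lemma dilog_has_field_derivative:
  assumes "norm z < 1"
  obtains D where "(dilog has_field_derivative D) (at z)" "z * D = - Ln (1 - z)"
proof -
  define c where "c = (\<lambda>k. 1 / of_nat k ^ 2 :: complex)"
  define D where "D = (\<Sum>k. diffs c k * z ^ k)"
  have diffs_c: "diffs c k = 1 / of_nat (Suc k)" for k
    by (simp add: diffs_def c_def power2_eq_square divide_simps del: of_nat_Suc)
  have sums: "(\<lambda>k. c k * y ^ k) sums dilog y" if "norm y \<le> 1" for y
    using dilog_sums[OF that] sums_Suc_iff[of "\<lambda>k. c k * y ^ k" "dilog y"] by (simp add: c_def)
  have "summable (\<lambda>k. c k * 1 ^ k)"
    using sums[of 1] by (simp add: sums_iff)
  hence "((\<lambda>y. \<Sum>k. c k * y ^ k) has_field_derivative D) (at z)"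
    unfolding D_def by (rule termdiffs_strong) (use assms in auto)
  moreover have "(\<Sum>k. c k * y ^ k) = dilog y" if "y \<in> ball 0 1" for y
    using sums[of y] that by (simp add: sums_iff)
  ultimately have "(dilog has_field_derivative D) (at z)"
    using assms by (elim has_field_derivative_transform_within_open[where S = "ball 0 1"]) auto
  moreover have "z * D = - Ln (1 - z)"
  proof -
    have "(\<lambda>k. - (z ^ k) / of_nat k) sums Ln (1 - z)"
      using Ln_series'[of "-z"] assms by simp
    hence "(\<lambda>k. - (z ^ Suc k) / of_nat (Suc k)) sums Ln (1 - z)"
      by (subst sums_Suc_iff) simp
    hence *: "(\<lambda>k. z * (diffs c k * z ^ k)) sums - Ln (1 - z)"
      using sums_minus by (fastforce simp: diffs_c)
    show ?thesis
    proof (cases "z = 0")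
      case False
      hence "summable (\<lambda>k. diffs c k * z ^ k)"
        using * by (simp add: sums_iff summable_cmult_iff)
      thus ?thesis
        using * by (simp add: sums_iff D_def suminf_mult)
    qed simp
  qed
  ultimately show ?thesis by (rule that)
qed

text \<open>
  The form \<open>d Li\<^sub>2(f) = - Ln (1 - f) d ln f\<close> of the chain rule, with \<open>g\<close> the logarithmic derivative of
  \<open>f\<close>. It also covers \<open>f t = 0\<close>, as happens on the path that belongs to the root \<open>w = -1\<close>.
\<close>
lemma dilog_compose_has_vector_derivative:
  fixes f :: "real \<Rightarrow> complex"
  assumes "(f has_vector_derivative f t * g) (at t)" "norm (f t) < 1"
  shows "((\<lambda>t. dilog (f t)) has_vector_derivative - Ln (1 - f t) * g) (at t)"
proof -
  obtain D where D: "(dilog has_field_derivative D) (at (f t))" "f t * D = - Ln (1 - f t)"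
    using dilog_has_field_derivative assms(2) by blast
  have "(dilog \<circ> f has_vector_derivative f t * g * D) (at t)"
    using assms(1) D(1) by (rule field_vector_diff_chain_at)
  moreover have "f t * g * D = - Ln (1 - f t) * g"
    using arg_cong[OF D(2), of "\<lambda>x. x * g"] by (simp add: mult_ac)
  ultimately show ?thesis by (simp add: o_def)
qed

text \<open>
  In the sum of the two series the odd powers cancel and the even ones form the series of
  \<open>dilog (z ^ 2)\<close>. At \<open>z = 1\<close> this yields \<open>dilog (-1)\<close> from the Basel sum.
\<close>
lemma dilog_duplication:
  assumes "norm z \<le> 1"
  shows "dilog z + dilog (-z) = dilog (z ^ 2) / 2"
proof -
  \<comment> \<open>The series starts at index 0 with the first power, so even powers sit at odd indices.\<close>
  define f where "f = (\<lambda>k. z ^ Suc k / of_nat (Suc k) ^ 2 + (-z) ^ Suc k / of_nat (Suc k) ^ 2)"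
  have "norm (z ^ 2) \<le> 1" using assms by (simp add: norm_power power_le_one)
  from sums_divide[OF dilog_sums[OF this], of 2]
  have "(\<lambda>k. f (2 * k + 1)) sums (dilog (z ^ 2) / 2)"
  proof (rule sums_cong[THEN iffD1, rotated])
    fix k
    have "2 * k + 1 + 1 = 2 * Suc k" by simp
    hence "f (2 * k + 1) = 2 * (z ^ (2 * Suc k) / of_nat (2 * Suc k) ^ 2)"
      by (simp add: f_def del: of_nat_Suc)
    also have "\<dots> = (z ^ 2) ^ Suc k / of_nat (Suc k) ^ 2 / 2"
      unfolding power_mult of_nat_mult power_mult_distrib by simp
    finally show "(z ^ 2) ^ Suc k / of_nat (Suc k) ^ 2 / 2 = f (2 * k + 1)" ..
  qed
  moreover have "f k = 0" if "k \<notin> range (\<lambda>k. 2 * k + 1)" for k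
  proof -
    have "even k"
      using that by (metis oddE rangeI)
    thus ?thesis by (simp add: f_def)
  qed
  ultimately have "f sums (dilog (z ^ 2) / 2)"
    by (subst (asm) sums_mono_reindex) (auto simp: strict_mono_def)
  moreover have "f sums (dilog z + dilog (-z))"
    unfolding f_def using assms by (intro sums_add dilog_sums) auto
  ultimately show ?thesis using sums_unique2 by blast
qed

lemma dilog_1: "dilog 1 = of_real (pi ^ 2 / 6)"
proof -
  have "(\<lambda>k. complex_of_real (1 / real (k + 1) ^ 2)) sums of_real (pi ^ 2 / 6)"
    using inverse_squares_sums by (subst sums_of_real_iff) simp
  thus ?thesis using sums_unique by (fastforce simp: dilog_def)
qed

lemma dilog_minus_1: "dilog (-1) = - of_real (pi ^ 2 / 12)"
  proof -
  have "of_real (pi ^ 2 / 6) + dilog (-1) = of_real (pi ^ 2 / 6) / 2"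
    using dilog_duplication[of 1] by (simp add: dilog_1)
  hence "dilog (-1) = of_real (pi ^ 2 / 6) / 2 - of_real (pi ^ 2 / 6)"
    by (metis add_diff_cancel_left')
  thus ?thesis by simp
qed

section \<open>The roots of \<open>w ^ n = -1\<close>\<close>

lemma norm_root_minus_one:
  assumes "(w::complex) ^ n = -1" "n > 0"
  shows "norm w = 1"
proof -
  have "norm w ^ n = 1" using assms by (simp flip: norm_power)
  thus ?thesis using assms(2) power_eq_imp_eq_base[of "norm w" n 1] by simp
qed

lemma prod_roots_minus_one:
  assumes "n > 0"
  shows "(\<Prod>w | w ^ n = -1. x - w) = (x::complex) ^ n + 1"
proof -
  define p :: "complex poly" where "p = monom 1 n + 1"
  have poly_p: "poly p y = y ^ n + 1" for y by (simp add: p_def poly_monom)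
  have "lead_coeff p = 1"
  proof -
    have "degree p = n" unfolding p_def using assms
      by (subst degree_add_eq_left) (auto simp: degree_monom_eq)
    thus ?thesis using assms by (simp add: p_def)
  qed
  moreover have "rsquarefree p"
    unfolding rsquarefree_roots
  proof (intro allI notI, elim conjE)
    fix a assume "poly p a = 0" "poly (pderiv p) a = 0"
    thus False using assms
      by (auto simp: poly_p p_def pderiv_add pderiv_monom poly_monom power_0_left)
  qed
  ultimately have "(\<Prod>z | poly p z = 0. [:-z, 1:]) = p"
    using complex_poly_decompose_rsquarefree[of p] by simp
  moreover have "{z. poly p z = 0} = {w. w ^ n = -1}"
    by (auto simp: poly_p eq_neg_iff_add_eq_0)
  ultimately have "poly (\<Prod>w | w ^ n = -1. [:-w, 1:]) x = poly p x" by simp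
  thus ?thesis by (simp add: poly_prod poly_p)
qed

text \<open>
  Both sides have the same exponential, by the factorisation of \<open>1 + t ^ n\<close>. So they could differ
  only by a multiple of \<open>2 \<pi> \<i>\<close>; that multiple is zero because conjugation permutes the roots,
  which makes the left-hand side real.
\<close>
lemma sum_Ln_roots_minus_one:
  fixes t :: real
  assumes "n > 0" "0 < t" "t < 1"
  shows "(\<Sum>w | w ^ n = -1. Ln (1 - of_real t * w)) = of_real (ln (1 + t ^ n))"
proof -
  let ?R = "{w::complex. w ^ n = -1}"
  define S where "S = (\<Sum>w\<in>?R. Ln (1 - of_real t * w))"
  have Re_pos: "Re (1 - of_real t * w) > 0" if "w \<in> ?R" for w
  proof -
    have "t * Re w \<le> t * 1"
      using that assms norm_root_minus_one[of w n] abs_Re_le_cmod[of w]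
      by (intro mult_left_mono) auto
    thus ?thesis using assms(3) by simp
  qed
  have "exp S = (\<Prod>w\<in>?R. 1 - of_real t * w)"
    unfolding S_def exp_sum[OF finite_nth_roots[OF assms(1)]]
    by (intro prod.cong refl exp_Ln) (metis Re_pos less_irrefl zero_complex.sel(1))
  also have "\<dots> = (\<Prod>w\<in>?R. of_real t * (1 / of_real t - w))"
    using assms by (simp add: algebra_simps)
  also have "\<dots> = of_real t ^ n * ((1 / of_real t) ^ n + 1)"
    using assms by (simp add: prod.distrib prod_roots_minus_one card_nth_roots)
  also have "\<dots> = of_real (1 + t ^ n)"
    using assms by (simp add: power_one_over field_simps)
  finally have exp_S: "exp S = of_real (1 + t ^ n)" .
  have "cnj S = (\<Sum>w\<in>?R. Ln (1 - of_real t * cnj w))"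
    unfolding S_def cnj_sum
  proof (rule sum.cong[OF refl])
    fix w assume "w \<in> ?R"
    hence "1 - of_real t * w \<notin> \<real>\<^sub>\<le>\<^sub>0"
      using Re_pos by (force simp: complex_nonpos_Reals_iff)
    from cnj_Ln[OF this]
    show "cnj (Ln (1 - of_real t * w)) = Ln (1 - of_real t * cnj w)" by simp
  qed
  also have "\<dots> = S"
    unfolding S_def
    by (rule sum.reindex_bij_witness[of _ cnj cnj]) (auto simp flip: complex_cnj_power)
  finally have "S \<in> \<real>" by (simp add: Reals_cnj_iff)
  then obtain s where s: "S = of_real s" by (auto elim: Reals_cases)
  with exp_S have "complex_of_real (exp s) = of_real (1 + t ^ n)"
    by (simp add: exp_of_real)
  hence "exp s = 1 + t ^ n" by (simp only: of_real_eq_iff)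
  hence "s = ln (1 + t ^ n)" by (metis ln_exp)
  thus ?thesis using s S_def by simp
qed

text \<open>
  The exponents for \<open>j = 1..n\<close> differ by less than \<open>2 \<pi>\<close> in imaginary part, hence give \<open>n\<close> distinct
  roots, which is all of them.
\<close>
lemma bij_betw_roots_minus_one:
  assumes "n > 0"
  shows "bij_betw (\<lambda>j. exp (of_real pi * \<i> / of_nat n * (2 * of_nat j + 1)))
           {1..n} {w::complex. w ^ n = -1}"
proof -
  let ?w = "\<lambda>j::nat. exp (of_real pi * \<i> / of_nat n * (2 * of_nat j + 1))"
  have "?w j ^ n = -1" for j
  proof -
    have "?w j ^ n = exp (of_nat n * (of_real pi * \<i> / of_nat n * (2 * of_nat j + 1)))"
      by (rule exp_of_nat_mult[symmetric])
    also have "\<dots> = exp (of_nat j * (2 * of_real pi * \<i>) + of_real pi * \<i>)"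
      using assms by (simp add: algebra_simps)
    also have "\<dots> = -1"
      unfolding exp_add exp_of_nat_mult by simp
    finally show ?thesis .
  qed
  hence sub: "?w ` {1..n} \<subseteq> {w. w ^ n = -1}" by auto
  have inj: "inj_on ?w {1..n}"
  proof (rule inj_onI)
    fix i j assume ij: "i \<in> {1..n}" "j \<in> {1..n}" "?w i = ?w j"
    have less: "\<bar>real i - real j\<bar> < real n" using ij(1,2) by auto
    define a where "a = (\<lambda>k::nat. complex_of_real pi * \<i> / of_nat n * (2 * of_nat k + 1))"
    have Im_diff: "Im (a i) - Im (a j) = 2 * pi * ((real i - real j) / real n)"
      using assms by (simp add: a_def field_simps Im_divide_of_nat)
    moreover have "\<bar>2 * pi * ((real i - real j) / real n)\<bar> < 2 * pi"
      using less assms by (simp add: abs_mult pos_divide_less_eq)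
    ultimately have "\<bar>Im (a i) - Im (a j)\<bar> < 2 * pi" by (simp only:)
    moreover have "exp (a i) = exp (a j)"
      using ij(3) unfolding a_def .
    ultimately have "a i = a j" by (rule exp_complex_eqI)
    hence "2 * pi * ((real i - real j) / real n) = 0"
      using Im_diff by (simp only: diff_self)
    thus "i = j" using assms by simp
  qed
  have "?w ` {1..n} = {w. w ^ n = -1}"
    using assms sub inj
    by (intro card_subset_eq finite_nth_roots) (auto simp: card_image card_nth_roots)
  with inj show ?thesis by (simp add: bij_betw_def)
qed

section \<open>A primitive of the integrand of \<open>J(n)\<close>\<close>

text \<open>
  The dilogarithms along the paths \<open>z\<^sub>w(t) = t (1 + w) / (1 + t)\<close>, corrected by primitives of the
  terms other than \<open>ln (1 + t ^ n) / (1 + t)\<close> in the derivative of their sum.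
\<close>
definition herglotz_J_primitive :: "nat \<Rightarrow> real \<Rightarrow> complex" where
  "herglotz_J_primitive n t =
     (\<Sum>w | w ^ n = -1. dilog (of_real (t / (1 + t)) * (1 + w)))
     - dilog (of_real (- (t ^ n))) / of_nat n + of_nat n * dilog (of_real (-t))
     + of_real (real n / 2 * ln (1 + t) ^ 2)"

lemma dilog_minus_power_has_vector_derivative:
  assumes "0 < t" "t < 1" "n > 0"
  shows "((\<lambda>t. dilog (of_real (- (t ^ n)))) has_vector_derivative
           of_real (- (real n * ln (1 + t ^ n) / t))) (at t)"
proof -
  have "((\<lambda>t. - (t ^ n)) has_real_derivative - (t ^ n) * (real n / t)) (at t)"
    using assms by (auto intro!: derivative_eq_intros simp: power_diff field_simps)
  hence "((\<lambda>t. complex_of_real (- (t ^ n))) has_vector_derivative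
           of_real (- (t ^ n) * (real n / t))) (at t)"
    by (intro has_vector_derivative_of_real) (simp add: has_real_derivative_iff_has_vector_derivative)
  hence "((\<lambda>t. dilog (of_real (- (t ^ n)))) has_vector_derivative
           - Ln (1 - of_real (- (t ^ n))) * of_real (real n / t)) (at t)"
    using assms
    by (intro dilog_compose_has_vector_derivative)
       (simp_all add: norm_power power_less_one_iff del: of_real_power)
  moreover have "Ln (1 - of_real (- (t ^ n))) = of_real (ln (1 + t ^ n))"
    using assms by (simp add: add_pos_pos flip: Ln_of_real)
  ultimately show ?thesis by (simp add: mult_ac)
qed

text \<open>
  The bound \<open>2 t / (1 + t)\<close> keeps the path \<open>z\<^sub>w\<close> in the open unit disc for \<open>t < 1\<close> and in the closed
  one at \<open>t = 1\<close>.
\<close>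
lemma norm_dilog_path_le:
  fixes w :: complex
  assumes "t \<ge> 0" "norm w = 1"
  shows "norm (of_real (t / (1 + t)) * (1 + w)) \<le> t / (1 + t) * 2"
proof -
  have "norm (of_real (t / (1 + t)) * (1 + w)) = t / (1 + t) * norm (1 + w)"
    using assms unfolding norm_mult norm_of_real by simp
  also have "\<dots> \<le> t / (1 + t) * 2"
    using assms norm_triangle_ineq[of 1 w] by (intro mult_left_mono) auto
  finally show ?thesis .
qed

text \<open>
  The logarithmic derivative of \<open>t / (1 + t)\<close> is \<open>1 / (t (1 + t))\<close>, and
  \<open>1 - z\<^sub>w(t) = (1 - t w) / (1 + t)\<close> splits the logarithm because the denominator is a positive real.
\<close>
lemma dilog_root_has_vector_derivative:
  fixes w :: complex
  assumes "0 < t" "t < 1" "norm w = 1"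
  shows "((\<lambda>t. dilog (of_real (t / (1 + t)) * (1 + w))) has_vector_derivative
           (of_real (ln (1 + t)) - Ln (1 - of_real t * w)) * of_real (1 / (t * (1 + t)))) (at t)"
proof -
  let ?z = "\<lambda>t. complex_of_real (t / (1 + t)) * (1 + w)"
  have "((\<lambda>t. t / (1 + t)) has_real_derivative t / (1 + t) * (1 / (t * (1 + t)))) (at t)"
    using assms by (auto intro!: derivative_eq_intros simp: divide_simps)
  hence "((\<lambda>t. complex_of_real (t / (1 + t))) has_vector_derivative
           of_real (t / (1 + t) * (1 / (t * (1 + t))))) (at t)"
    by (intro has_vector_derivative_of_real) (simp add: has_real_derivative_iff_has_vector_derivative)
  hence "(?z has_vector_derivative of_real (t / (1 + t) * (1 / (t * (1 + t)))) * (1 + w)) (at t)"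
    by (rule has_vector_derivative_mult_left)
  hence "(?z has_vector_derivative ?z t * of_real (1 / (t * (1 + t)))) (at t)"
    by (simp only: of_real_mult mult_ac)
  moreover have "norm (?z t) < 1"
  proof -
    have "norm (?z t) \<le> t / (1 + t) * 2"
      using assms by (intro norm_dilog_path_le) auto
    also have "\<dots> < 1"
      using assms by (simp add: field_simps)
    finally show ?thesis .
  qed
  ultimately have "((\<lambda>t. dilog (?z t)) has_vector_derivative
      - Ln (1 - ?z t) * of_real (1 / (t * (1 + t)))) (at t)"
    by (rule dilog_compose_has_vector_derivative)
  moreover have "Ln (1 - ?z t) = Ln (1 - of_real t * w) - of_real (ln (1 + t))"
  proof -
    have "complex_of_real (1 + t) \<noteq> 0"
      using assms by (simp only: of_real_eq_0_iff)
    hence "1 - ?z t = (1 - of_real t * w) / of_real (1 + t)"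
      by (simp add: field_simps)
    moreover have "1 - of_real t * w \<noteq> 0"
    proof
      assume "1 - of_real t * w = 0"
      hence "norm (of_real t * w) = 1" by simp
      thus False using assms by (simp add: norm_mult)
    qed
    ultimately show ?thesis using assms by (simp add: Ln_divide_of_real del: of_real_add)
  qed
  ultimately show ?thesis by (simp only: minus_diff_eq)
qed

lemma herglotz_J_primitive_has_vector_derivative:
  assumes "0 < t" "t < 1" "n > 0"
  shows "(herglotz_J_primitive n has_vector_derivative of_real (ln (1 + t ^ n) / (1 + t))) (at t)"
proof -
  let ?R = "{w::complex. w ^ n = -1}"
  let ?g = "1 / (t * (1 + t))"
  have "((\<lambda>t. \<Sum>w\<in>?R. dilog (of_real (t / (1 + t)) * (1 + w))) has_vector_derivative
          (\<Sum>w\<in>?R. (of_real (ln (1 + t)) - Ln (1 - of_real t * w)) * of_real ?g)) (at t)"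
    using assms by (intro has_vector_derivative_sum dilog_root_has_vector_derivative)
                   (auto intro: norm_root_minus_one)
  also have "(\<Sum>w\<in>?R. (of_real (ln (1 + t)) - Ln (1 - of_real t * w)) * of_real ?g) =
             of_real ((real n * ln (1 + t) - ln (1 + t ^ n)) * ?g)"
    using assms
    unfolding sum_distrib_right[symmetric] sum_subtractf
    by (simp add: sum_Ln_roots_minus_one card_nth_roots)
  finally have 1: "((\<lambda>t. \<Sum>w\<in>?R. dilog (of_real (t / (1 + t)) * (1 + w))) has_vector_derivative
      of_real ((real n * ln (1 + t) - ln (1 + t ^ n)) * ?g)) (at t)" .
  have "((\<lambda>t. dilog (of_real (- (t ^ n))) / of_nat n) has_vector_derivative
          of_real (- (real n * ln (1 + t ^ n) / t)) / of_nat n) (at t)"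
    using assms by (intro has_vector_derivative_divide dilog_minus_power_has_vector_derivative)
  hence 2: "((\<lambda>t. dilog (of_real (- (t ^ n))) / of_nat n) has_vector_derivative
             of_real (- (ln (1 + t ^ n) / t))) (at t)"
    using assms by simp
  have 3: "((\<lambda>t. of_nat n * dilog (of_real (-t))) has_vector_derivative
             of_real (- (real n * ln (1 + t) / t))) (at t)"
    using has_vector_derivative_mult_right[OF dilog_minus_power_has_vector_derivative[of t 1]] assms
    by simp
  have "((\<lambda>t. real n / 2 * ln (1 + t) ^ 2) has_real_derivative real n * ln (1 + t) / (1 + t)) (at t)"
    using assms by (auto intro!: derivative_eq_intros simp: divide_simps)
  hence 4: "((\<lambda>t. complex_of_real (real n / 2 * ln (1 + t) ^ 2)) has_vector_derivative
              of_real (real n * ln (1 + t) / (1 + t))) (at t)"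
    by (intro has_vector_derivative_of_real) (simp add: has_real_derivative_iff_has_vector_derivative)
  have "(herglotz_J_primitive n has_vector_derivative
          of_real ((real n * ln (1 + t) - ln (1 + t ^ n)) * ?g - - (ln (1 + t ^ n) / t)
                   + - (real n * ln (1 + t) / t) + real n * ln (1 + t) / (1 + t))) (at t)"
    unfolding herglotz_J_primitive_def[abs_def] of_real_add[where 'a = complex] of_real_diff
    using 1 2 3 4 by (intro has_vector_derivative_add has_vector_derivative_diff)
  also have "(real n * ln (1 + t) - ln (1 + t ^ n)) * ?g - - (ln (1 + t ^ n) / t)
             + - (real n * ln (1 + t) / t) + real n * ln (1 + t) / (1 + t) = ln (1 + t ^ n) / (1 + t)"
    using assms by (simp add: divide_simps) (simp add: algebra_simps)
  finally show ?thesis .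
qed

lemma continuous_on_herglotz_J_primitive:
  assumes "n > 0"
  shows "continuous_on {0..1} (herglotz_J_primitive n)"
proof -
  have dilog_comp: "continuous_on {0..1} (\<lambda>t. dilog (f t))"
    if "continuous_on {0..1::real} f" "\<And>t. t \<in> {0..1} \<Longrightarrow> norm (f t) \<le> 1" for f
    using that by (intro continuous_on_compose2[OF continuous_on_dilog]) auto
  have "norm (of_real (t / (1 + t)) * (1 + w)) \<le> 1"
    if "w ^ n = -1" "t \<in> {0..1}" for w :: complex and t
  proof -
    have "norm (of_real (t / (1 + t)) * (1 + w)) \<le> t / (1 + t) * 2"
      using that assms by (intro norm_dilog_path_le norm_root_minus_one) auto
    also have "\<dots> \<le> 1"
      using that by (simp add: field_simps)
    finally show ?thesis .
  qed
  thus ?thesis unfolding herglotz_J_primitive_def[abs_def]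
    by (intro continuous_intros dilog_comp)
       (use assms in \<open>auto simp: norm_power power_le_one\<close>)
qed

lemma herglotz_J_primitive_0: "n > 0 \<Longrightarrow> herglotz_J_primitive n 0 = 0"
  by (simp add: herglotz_J_primitive_def power_0_left)

lemma herglotz_J_primitive_1:
  assumes "n > 0"
  shows "herglotz_J_primitive n 1 =
    of_real (pi ^ 2 / 12 * (1 / real n - real n) + real n / 2 * (ln 2) ^ 2)
    + (\<Sum>j = 1..n. dilog (1 / 2 * (1 + exp (of_real pi * \<i> / of_nat n * (2 * of_nat j + 1)))))"
proof -
  define S where "S =
    (\<Sum>j = 1..n. dilog (1 / 2 * (1 + exp (of_real pi * \<i> / of_nat n * (2 * of_nat j + 1)))))"
  have "(\<Sum>w | w ^ n = -1. dilog (1 / 2 * (1 + w))) = S"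
    unfolding S_def
    by (rule sum.reindex_bij_betw[OF bij_betw_roots_minus_one[OF assms], symmetric])
  hence "herglotz_J_primitive n 1 =
      S - dilog (-1) / of_nat n + of_nat n * dilog (-1) + of_real (real n / 2 * (ln 2) ^ 2)"
    by (simp add: herglotz_J_primitive_def)
  also have "\<dots> = of_real (pi ^ 2 / 12 * (1 / real n - real n) + real n / 2 * (ln 2) ^ 2) + S"
    by (simp add: dilog_minus_1 algebra_simps diff_divide_distrib)
  finally show ?thesis unfolding S_def .
qed

section \<open>Evaluation of \<open>J(n)\<close> and \<open>J(1/n)\<close>\<close>

lemma herglotz_J_of_nat:
  assumes "n > 0"
  shows "herglotz_J (of_nat n) = herglotz_J_primitive n 1"
proof -
  have "((\<lambda>t::real. Ln (1 + of_real t powr of_nat n) / (1 + of_real t)) has_integral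
          herglotz_J_primitive n 1 - herglotz_J_primitive n 0) {0..1}"
  proof (rule fundamental_theorem_of_calculus_interior)
    fix t :: real assume t: "t \<in> {0<..<1}"
    have "Ln (1 + of_real t powr of_nat n) = of_real (ln (1 + t ^ n))"
      using t assms by (simp add: powr_nat' add_pos_pos flip: Ln_of_real)
    thus "(herglotz_J_primitive n has_vector_derivative
            Ln (1 + of_real t powr of_nat n) / (1 + of_real t)) (at t)"
      using herglotz_J_primitive_has_vector_derivative[of t n] t assms by simp
  qed (use assms in \<open>auto intro: continuous_on_herglotz_J_primitive\<close>)
  thus ?thesis unfolding herglotz_J_def
    using assms by (simp add: integral_unique herglotz_J_primitive_0)
qed

text \<open>
  This is \<open>J(n) + J(1/n) = ln\<^sup>2 2\<close>. With \<open>s = root n t\<close>, the product rule applied to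
  \<open>ln (1 + s) ln (1 + t)\<close> gives the integrand \<open>ln (1 + s) / (1 + t)\<close> plus
  \<open>s' ln (1 + s ^ n) / (1 + s)\<close>, and the latter is the derivative of the primitive for \<open>J(n)\<close>
  composed with \<open>root n\<close>.
\<close>
lemma herglotz_J_inverse_of_nat:
  assumes "n > 0"
  shows "herglotz_J (1 / of_nat n) = of_real (ln 2 ^ 2) - herglotz_J_primitive n 1"
proof -
  define G where "G = (\<lambda>t. complex_of_real (ln (1 + root n t) * ln (1 + t)) -
                            herglotz_J_primitive n (root n t))"
  have "((\<lambda>t::real. Ln (1 + of_real t powr (1 / of_nat n)) / (1 + of_real t)) has_integral
          G 1 - G 0) {0..1}"
  proof (rule fundamental_theorem_of_calculus_interior)
    have "continuous_on {0..1} (\<lambda>t. herglotz_J_primitive n (root n t))"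
      using assms by (intro continuous_on_compose2[OF continuous_on_herglotz_J_primitive])
                     (auto intro!: continuous_intros)
    moreover have "1 + root n t \<noteq> 0" if "t \<in> {0..1}" for t
    proof -
      have "0 \<le> root n t" using that by (intro real_root_ge_zero) auto
      thus ?thesis by linarith
    qed
    ultimately show "continuous_on {0..1} G"
      unfolding G_def by (intro continuous_intros) auto
  next
    fix t :: real assume t: "t \<in> {0<..<1}"
    define s where "s = root n t"
    have s: "0 < s" "s < 1" "s ^ n = t"
      using t assms by (auto simp: s_def)
    define s' where "s' = inverse (real n * s ^ (n - Suc 0))"
    have root: "(root n has_real_derivative s') (at t)"
      unfolding s'_def s_def using t assms by (intro DERIV_real_root) auto
    have "(herglotz_J_primitive n \<circ> root n has_vector_derivative
            s' *\<^sub>R of_real (ln (1 + s ^ n) / (1 + s))) (at t)"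
      using root herglotz_J_primitive_has_vector_derivative[OF s(1,2) assms]
      unfolding s_def
      by (intro vector_diff_chain_at) (simp_all add: has_real_derivative_iff_has_vector_derivative)
    hence J: "((\<lambda>t. herglotz_J_primitive n (root n t)) has_vector_derivative
            of_real (s' * ln (1 + t) / (1 + s))) (at t)"
      by (simp add: o_def s(3) scaleR_conv_of_real)
    have "((\<lambda>t. ln (1 + root n t) * ln (1 + t)) has_real_derivative
            s' / (1 + s) * ln (1 + t) + 1 / (1 + t) * ln (1 + s)) (at t)"
      using t s(1) assms unfolding s_def s'_def
      by (auto intro!: derivative_eq_intros add_pos_pos)
    hence "((\<lambda>t. complex_of_real (ln (1 + root n t) * ln (1 + t))) has_vector_derivative
            of_real (s' / (1 + s) * ln (1 + t) + 1 / (1 + t) * ln (1 + s))) (at t)"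
      by (intro has_vector_derivative_of_real) (simp add: has_real_derivative_iff_has_vector_derivative)
    from has_vector_derivative_diff[OF this J]
    have "(G has_vector_derivative of_real (ln (1 + s) / (1 + t))) (at t)"
      unfolding G_def by (simp add: algebra_simps)
    moreover have "complex_of_real t powr (1 / of_nat n) = of_real s"
      using powr_of_real[of t "1 / real n"] t assms by (simp add: s_def root_powr_inverse)
    hence "Ln (1 + of_real t powr (1 / of_nat n)) = of_real (ln (1 + s))"
      using s by (simp add: add_pos_pos flip: Ln_of_real)
    ultimately show "(G has_vector_derivative
        Ln (1 + of_real t powr (1 / of_nat n)) / (1 + of_real t)) (at t)" by simp
  qed simp
  moreover have "G 1 - G 0 = of_real (ln 2 ^ 2) - herglotz_J_primitive n 1"
    using assms by (simp add: G_def herglotz_J_primitive_0 power2_eq_square)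
  ultimately show ?thesis unfolding herglotz_J_def by (simp add: integral_unique)
qed

theorem corollary3p5:
  fixes n :: nat
  assumes "n > 0"
  shows "herglotz_J (of_nat n) =
           of_real (pi ^ 2 / 12 * (1 / real n - real n) + real n / 2 * (ln 2) ^ 2)
           + (\<Sum>j = 1..n. dilog (1 / 2 * (1 + exp (of_real pi * \<i> / of_nat n * (2 * of_nat j + 1)))))
    \<and> herglotz_J (1 / of_nat n) =
           of_real (pi ^ 2 / 12 * (real n - 1 / real n) + (1 - real n / 2) * (ln 2) ^ 2)
           - (\<Sum>j = 1..n. dilog (1 / 2 * (1 + exp (of_real pi * \<i> / of_nat n * (2 * of_nat j + 1)))))"
proof -
  have "(ln 2)\<^sup>2 - (pi ^ 2 / 12 * (1 / real n - real n) + real n / 2 * (ln 2) ^ 2) =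
        pi ^ 2 / 12 * (real n - 1 / real n) + (1 - real n / 2) * (ln 2) ^ 2"
    by (simp add: algebra_simps diff_divide_distrib)
  thus ?thesis
    unfolding herglotz_J_of_nat[OF assms] herglotz_J_inverse_of_nat[OF assms]
      herglotz_J_primitive_1[OF assms]
    by (intro conjI refl) (simp only: diff_diff_eq[symmetric] of_real_diff[symmetric])
qed

end
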